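(* For all $n \ge 2$, the following recurrences hold (with $G,K\in\mathcal{M}$): $$|\mathcal{M}_n| = 2^{|\mathcal{M}_{n-1}|} - \sum_{G \in \mathcal{M}_{n-2}} |\mathcal{R}_n^G|;$$ $$|\mathcal{R}_n^G| = \begin{cases} 2^{|\mathcal{S}_{n-1}^G|} - 1 & \text{if } G \not\cong 0,\\ 2^{|\mathcal{S}_{n-1}^G|} - 2^{|\mathcal{N}_{n-1}^0|} & \text{if } G \cong 0;\end{cases}$$ $$|\mathcal{S}_n^K| = 2^{|\mathcal{M}_{n-1}|-1} - \sum_{G \in K} |\mathcal{R}_n^{G,K}| - \sum_{G \in \mathcal{S}_{n-2}^K} |\mathcal{R}_n^G|;$$ $$|\mathcal{R}_n^{G,K}| = \begin{cases} 2^{|\mathcal{S}_{n-1}^G|-1} & \text{if } G \not\cong 0 \text{ or } K \text{ is a } \mathscr{P}\text{-position},\\ 2^{|\mathcal{S}_{n-1}^G|-1} - 2^{|\mathcal{N}_{n-1}^0|-1} & \text{if } G \cong 0 \text{ and } K \text{ is an } \mathscr{N}\text{-position}\end{cases}$$ (where $|\mathcal{R}_n^{G,K}|$ is defined only when $G\in K$); $$|\mathcal{N}_n| = 2^{|\mathcal{M}_{n-1}|} - 2^{|\mathcal{N}_{n-1}|} + 1 - \sum_{G \in \mathcal{N}_{n-2}} |\mathcal{R}_n^G|;$$ $$|\mathcal{N}_n^0| = 2^{|\mathcal{M}_{n-1}|-1} - 2^{|\mathcal{N}_{n-1}|-1} - \sum_{G \in \mathcal{N}_{n-2}^0} |\m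athcal{R}_n^G|.$$
   Context: A (misère impartial) game is a hereditarily finite set; its elements are called its options, and $G\cong H$ means $G$ and $H$ are identical as sets. $0=\{\}$. The sum is $G+H=\{G'+H: G'\in G\}\cup\{G+H':H'\in H\}$. Misère outcome: $G$ is a $\mathscr{P}$-position if $G$ is nonempty and every option of $G$ is an $\mathscr{N}$-position; otherwise $G$ is an $\mathscr{N}$-position (so $0$ is an $\mathscr{N}$-position). $G=H$ means that $G+X$ and $H+X$ have the same misère outcome for every game $X$. An option $G'$ of $G$ is reversible if $G'$ has an option $G''$ with $G''=G$. $G$ is in simplest (canonical) form if neither $G$ nor any game reachable from $G$ by a sequence of moves has a reversible option; every game is equal to exactly one game in simplest form (up to $\cong$). $\mathcal{M}$ denotes the set of all game values, each identified with its simplest form. The formal birthday is $\tilde{\mathrm b}(0)=0$, $\tilde{\mathrm b}(G)=\max\{\tilde{\mathrm b}(G')+1:G'\in G\}$, and the birthday is $\mathrm b(G)=\min\{\tilde{\mathrm b}(H):H=G\}$. $\mathcal{M}_n=\{G\in\mathcal{M}:\mathrm b(G)\le n\}$. A subset $H\subset\mathcal{M}_{n-1}$ is regarded as a game whose options are its elements (in simplest form). Let $G\cong\{G_1',\ldots,G_k'\}$ and let $H\cong\{G_1',\ldots,G_k',H_1',\ldots,H_l'\}$ be a game whose options include those of $G$. $H$ simplifies to $G$ provided that (i) $G\in H_j'$ for each $H_j'$, and (ii) if $G\cong 0$, then $H$ is an $\mathscr{N}$-position. For $n\ge0$ and $G,K\in\mathcal{M}$: $\mathcal{R}_n^G=\{H\subset\mathcal{M}_{n-1}: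 H\text{ simplifies to }G\}$; $\mathcal{S}_n^K=\{H\in\mathcal{M}_n:K\in H\}$; $\mathcal{R}_n^{G,K}=\{H\subset\mathcal{M}_{n-1}:H\text{ simplifies to }G\text{ and }K\in H\}$ (defined only when $G\in K$); $\mathcal{N}_n=\{H\in\mathcal{M}_n:H\text{ is an }\mathscr{N}\text{-position}\}$; $\mathcal{N}_n^0=\{H\in\mathcal{M}_n:H\text{ is an }\mathscr{N}\text{-position and }0\in H\}$. $|X|$ denotes cardinality.
   Formalization: The recurrences for |S_n^K| and |R_n^{G,K}| are proved for K in M_{n-1} rather than all K in M; for any other K both sets are empty while the right-hand sides are nonzero (e.g. n=2, K={0,{0}}). *)

theory Defs
  imports Main "HOL-Library.FSet"
begin

text \<open>
  Misere impartial games are hereditarily finite sets. The datatype below is the free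
  algebra on finite sets, so HOL equality on \<open>game\<close> is identity as sets; equality of
  games in the sense of misere play is the coarser relation \<open>game_eq\<close>.
\<close>

datatype game = Game (options: "game fset")

lemma wf_option: "wf {(G', G). G' |\<in>| options G}"
proof (rule wfUNIVI)
  fix P :: "game \<Rightarrow> bool" and G
  assume *: "\<forall>G. (\<forall>G'. (G', G) \<in> {(G', G). G' |\<in>| options G} \<longrightarrow> P G') \<longrightarrow> P G"
  show "P G"
  proof (induction G)
    case (Game F)
    then show ?case using * by simp
  qed
qed

instantiation game :: "{zero, plus}"
begin

definition zero_game :: game where
  "0 = Game {||}"

function plus_game :: "game \<Rightarrow> game \<Rightarrow> game" where
  "plus_game G H =
     Game ((\<lambda>G'. plus_game G' H) |`| options G |\<union>| (\<lambda>H'. plus_game G H') |`| options H)"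
  by pat_completeness auto
termination
  by (relation "{(G', G). G' |\<in>| options G} <*lex*> {(H', H). H' |\<in>| options H}")
     (auto intro: wf_option)

instance ..

end

declare plus_game.simps [simp del]

function P_position :: "game \<Rightarrow> bool" where
  "P_position G \<longleftrightarrow> options G \<noteq> {||} \<and> (\<forall>G' |\<in>| options G. \<not> P_position G')"
  by pat_completeness auto
termination
  by (relation "{(G', G). G' |\<in>| options G}") (auto intro: wf_option)

declare P_position.simps [simp del]

definition N_position :: "game \<Rightarrow> bool" where
  "N_position G \<longleftrightarrow> \<not> P_position G"

definition game_eq :: "game \<Rightarrow> game \<Rightarrow> bool"  (infix "\<doteq>" 50) where
  "G \<doteq> H \<longleftrightarrow> (\<forall>X. P_position (G + X) \<longleftrightarrow> P_position (H + X))"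

definition reversible_option :: "game \<Rightarrow> game \<Rightarrow> bool" where
  "reversible_option G G' \<longleftrightarrow> G' |\<in>| options G \<and> (\<exists>G'' |\<in>| options G'. G'' \<doteq> G)"

definition reachable :: "game \<Rightarrow> game \<Rightarrow> bool" where
  "reachable = (\<lambda>G G'. G' |\<in>| options G)\<^sup>*\<^sup>*"

definition simplest_form :: "game \<Rightarrow> bool" where
  "simplest_form G \<longleftrightarrow> (\<forall>X. reachable G X \<longrightarrow> \<not> (\<exists>X'. reversible_option X X'))"

text \<open>Game values, each identified with its simplest form.\<close>

definition game_values :: "game set" where
  "game_values = {G. simplest_form G}"

function formal_birthday :: "game \<Rightarrow> nat" where
  "formal_birthday G =
     (if options G = {||} then 0 else fMax ((\<lambda>G'. formal_birthday G' + 1) |`| options G))"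
  by pat_completeness auto
termination
  by (relation "{(G', G). G' |\<in>| options G}") (auto intro: wf_option)

declare formal_birthday.simps [simp del]

definition birthday :: "game \<Rightarrow> nat" where
  "birthday G = (LEAST k. \<exists>H. H \<doteq> G \<and> formal_birthday H = k)"

definition M :: "nat \<Rightarrow> game set" where
  "M n = {G \<in> game_values. birthday G \<le> n}"

text \<open>
  \<open>simplifies H G\<close> means that \<open>H\<close> arises from \<open>G\<close> by adding at least one new option
  \<open>H\<^sub>j'\<close>; in particular \<open>G\<close> does not simplify to itself.  No generality is lost by letting the
  \<open>H\<^sub>j'\<close> range over the options of \<open>H\<close> that are not options of \<open>G\<close>: each \<open>H\<^sub>j'\<close> has \<open>G\<close> as an
  option, and by well-foundedness no option of \<open>G\<close> has that property.
\<close>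

definition simplifies :: "game \<Rightarrow> game \<Rightarrow> bool" where
  "simplifies H G \<longleftrightarrow>
     options G |\<subset>| options H \<and>
     (\<forall>H' |\<in>| options H |-| options G. G |\<in>| options H') \<and>
     (G = 0 \<longrightarrow> N_position H)"

text \<open>
  A subset of \<open>M (n - 1)\<close> is represented by the game having it as its set of options
  (\<open>M (n - 1)\<close> is finite, so every subset of it is a game).
  The strict inequality \<open>birthday H' < n\<close> encodes membership in \<open>M (n - 1)\<close>, where
  \<open>M (- 1)\<close> is empty; truncated subtraction would give the wrong set for \<open>n = 0\<close>.
\<close>

definition R :: "nat \<Rightarrow> game \<Rightarrow> game set" where
  "R n G = {H. fset (options H) \<subseteq> {H' \<in> game_values. birthday H' < n} \<and> simplifies H G}"

definition S :: "nat \<Rightarrow> game \<Rightarrow> game set" where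
  "S n K = {H \<in> M n. K |\<in>| options H}"

text \<open>Only meaningful when \<open>G\<close> is an option of \<open>K\<close>.\<close>

definition RK :: "nat \<Rightarrow> game \<Rightarrow> game \<Rightarrow> game set" where
  "RK n G K = {H \<in> R n G. K |\<in>| options H}"

definition N :: "nat \<Rightarrow> game set" where
  "N n = {H \<in> M n. N_position H}"

definition N0 :: "nat \<Rightarrow> game set" where
  "N0 n = {H \<in> M n. N_position H \<and> 0 |\<in>| options H}"

end

theory Submission
  imports Defs
begin

text \<open>
  A game whose options lie in \<open>M (n - 1)\<close> is just a subset of \<open>M (n - 1)\<close>, so there are
  \<open>2 ^ |M (n - 1)|\<close> of them. Those in simplest form are the members of \<open>M n\<close>
  (\<open>M_Suc\<close>). Every other one equals a unique game \<open>G\<close> in simplest form, and the key fact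
  \<open>not_simplest_form_iff_simplifies\<close> is that it is then obtained from \<open>G\<close> by adding
  options that have \<open>G\<close> as an option themselves. Such a \<open>G\<close> lies two moves below, hence in
  \<open>M (n - 2)\<close>. Thus the subsets of \<open>M (n - 1)\<close> are partitioned into \<open>M n\<close> and the sets
  \<open>R n G\<close> with \<open>G\<close> in \<open>M (n - 2)\<close>, and restricting this partition to the games with a
  given property gives the recurrences for \<open>M\<close>, \<open>S\<close>, \<open>N\<close> and \<open>N0\<close>
  (\<open>card_M_filter\<close>). For \<open>N\<close> and \<open>N0\<close> the property is constant on each \<open>R n G\<close>, since
  equal games have the same outcome. For \<open>S\<close> it holds throughout \<open>R n G\<close> if \<open>K\<close> is an option
  of \<open>G\<close>, and otherwise it forces \<open>K\<close> to be an additional option, so that \<open>G\<close> is an option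
  of \<open>K\<close>.

  The sizes of \<open>R n G\<close> and \<open>RK n G K\<close> are those of intervals in a power set: the additional
  options form an arbitrary nonempty subset of \<open>S (n - 1) G\<close>, and for \<open>G = 0\<close> the proviso
  excludes the subsets of \<open>N0 (n - 1)\<close>.

  What remains is the theory of misere simplest forms. All of it rests on the linking
  theorem (\<open>linked_cases\<close>): if \<open>G + T\<close> and \<open>H + T\<close> are never \<open>\<P>\<close>-positions at the
  same time, then one of \<open>G\<close> and \<open>H\<close> equals an option of the other. Applied to \<open>G\<close> and an
  option of an equal game (\<open>game_eq_option_cases\<close>), it shows both that simplest forms are
  unique and that a reversible game simplifies as claimed. Uniqueness also identifies the
  birthday of a simplest form with its formal birthday, which makes \<open>M n\<close> computable from
  \<open>M (n - 1)\<close>.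
\<close>

section \<open>Outcomes of sums\<close>

lemma game_option_induct [case_names option]:
  assumes "\<And>G. (\<And>G'. G' |\<in>| options G \<Longrightarrow> P G') \<Longrightarrow> P G"
  shows "P G"
  using assms by (induction G rule: wf_induct_rule[OF wf_option]) auto

lemma option_asym: "G |\<in>| options H \<Longrightarrow> H |\<notin>| options G"
  using wf_asym[OF wf_option] by blast

lemma options_zero [simp]: "options 0 = {||}"
  by (simp add: zero_game_def)

lemma options_eq_empty_iff [simp]: "options G = {||} \<longleftrightarrow> G = 0"
  by (cases G) (simp add: zero_game_def)

lemma fset_options_eq_empty_iff [simp]: "fset (options G) = {} \<longleftrightarrow> G = 0"
  by (metis bot_fset.rep_eq fset_inject options_eq_empty_iff)

lemma plus_zero_right [simp]: "G + 0 = (G :: game)"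
proof (induction G rule: game_option_induct)
  case (option G)
  then have "(\<lambda>G'. G' + 0) |`| options G = options G"
    by (auto simp: image_iff)
  then show ?case
    by (subst plus_game.simps) simp
qed

lemma P_position_iff:
  "P_position G \<longleftrightarrow> G \<noteq> 0 \<and> (\<forall>G' |\<in>| options G. \<not> P_position G')"
  by (subst P_position.simps) simp

lemma P_position_plus_iff:
  "P_position (G + X) \<longleftrightarrow>
     (G \<noteq> 0 \<or> X \<noteq> 0) \<and> (\<forall>G' |\<in>| options G. \<not> P_position (G' + X))
     \<and> (\<forall>X' |\<in>| options X. \<not> P_position (G + X'))"
proof -
  have opt: "options (G + X) = (\<lambda>G'. G' + X) |`| options G |\<union>| (\<lambda>X'. G + X') |`| options X"
    by (subst plus_game.simps) simp
  have "G + X = 0 \<longleftrightarrow> G = 0 \<and> X = 0"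
    using opt options_eq_empty_iff[of "G + X"] by auto
  then show ?thesis
    by (subst P_position_iff) (auto simp: opt)
qed

lemma not_P_position_plusI1:
  "G' |\<in>| options G \<Longrightarrow> P_position (G' + X) \<Longrightarrow> \<not> P_position (G + X)"
  using P_position_plus_iff by blast

lemma not_P_position_plusI2:
  "X' |\<in>| options X \<Longrightarrow> P_position (G + X') \<Longrightarrow> \<not> P_position (G + X)"
  using P_position_plus_iff by blast

lemma P_position_plusI:
  assumes "T \<noteq> 0"
    and "\<And>G'. G' |\<in>| options G \<Longrightarrow> \<exists>X |\<in>| options T. P_position (G' + X)"
    and "\<And>X. X |\<in>| options T \<Longrightarrow> \<not> P_position (G + X)"
  shows "P_position (G + T)"
  using assms P_position_plus_iff[of G T] not_P_position_plusI2 by blast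

section \<open>Equality and linking\<close>

lemma game_eq_refl [simp]: "G \<doteq> G"
  by (simp add: game_eq_def)

lemma game_eq_sym: "G \<doteq> H \<Longrightarrow> H \<doteq> G"
  by (simp add: game_eq_def)

lemma game_eq_trans: "G \<doteq> H \<Longrightarrow> H \<doteq> K \<Longrightarrow> G \<doteq> K"
  by (simp add: game_eq_def)

lemma game_eq_P_position: "G \<doteq> H \<Longrightarrow> P_position G \<longleftrightarrow> P_position H"
  unfolding game_eq_def by (metis plus_zero_right)

text \<open>
  By induction on \<open>X\<close>, each move from one of the two sums with \<open>X\<close> has a counterpart with
  the same outcome in the other.
\<close>

lemma game_eq_replace_each_option:
  assumes "\<And>G'. G' |\<in>| options G \<Longrightarrow> f G' \<doteq> G'"
  shows "Game (f |`| options G) \<doteq> G"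
proof -
  have "P_position (Game (f |`| options G) + X) \<longleftrightarrow> P_position (G + X)" for X
  proof (induction X rule: game_option_induct)
    case (option X)
    have ne: "Game (f |`| options G) \<noteq> 0 \<longleftrightarrow> G \<noteq> 0"
      by (simp flip: options_eq_empty_iff)
    have "P_position (f G' + X) \<longleftrightarrow> P_position (G' + X)" if "G' |\<in>| options G" for G'
      using assms[OF that] by (simp add: game_eq_def)
    then show ?case
      using option ne
      by (simp add: P_position_plus_iff[of G X] P_position_plus_iff[of "Game (f |`| options G)" X])
  qed
  then show ?thesis
    by (simp add: game_eq_def)
qed

text \<open>
  The witness is Conway's mate \<open>G\<^sup>-\<close>, whose options are the mates of the options of \<open>G\<close>:
  every move in \<open>G + G\<^sup>-\<close> can be answered by a move to some \<open>G' + G'\<^sup>-\<close>. The exception is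
  \<open>0\<close>, with mate \<open>{0}\<close>, because the player without a move wins.
\<close>

lemma ex_mate: "\<exists>T. P_position (G + T)"
proof (induction G rule: game_option_induct)
  case (option G)
  then obtain m where m: "\<And>G'. G' |\<in>| options G \<Longrightarrow> P_position (G' + m G')"
    by metis
  show ?case
  proof (cases "G = 0")
    case True
    have "\<not> P_position (0 + 0)"
      by (simp add: P_position_iff[of 0])
    then have "P_position (0 + Game {|0|})"
      by (subst P_position_plus_iff) (simp add: zero_game_def)
    then show ?thesis
      using True by blast
  next
    case False
    have "\<not> P_position (G + m G')" if "G' |\<in>| options G" for G'
      using m that not_P_position_plusI1 by blast
    then have "P_position (G + Game (m |`| options G))"
      using False m by (intro P_position_plusI) (auto simp flip: options_eq_empty_iff)
    then show ?thesis ..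
  qed
qed

text \<open>
  A game telling \<open>G\<close> and \<open>H\<close> apart may give the wrong one of them the
  \<open>\<P>\<close>-position. In that case, offering it as an option, next to mates of the options of
  \<open>G\<close>, exchanges the two outcomes.
\<close>

lemma distinguishing_game:
  assumes "\<not> G \<doteq> H"
  shows "\<exists>T. P_position (G + T) \<and> \<not> P_position (H + T)"
proof -
  obtain X where X: "P_position (G + X) \<noteq> P_position (H + X)"
    using assms by (auto simp: game_eq_def)
  show ?thesis
  proof (cases "P_position (G + X)")
    case True
    then show ?thesis
      using X by blast
  next
    case False
    obtain m where m: "\<And>G'. P_position (G' + m G')"
      using ex_mate by metis
    define T where "T = Game (finsert X (m |`| options G))"
    have opt: "options T = finsert X (m |`| options G)"
      by (simp add: T_def)
    then have "T \<noteq> 0"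
      by (simp flip: options_eq_empty_iff)
    moreover have "\<not> P_position (G + m G')" if "G' |\<in>| options G" for G'
      using m that not_P_position_plusI1 by blast
    ultimately have "P_position (G + T)"
      using False m by (intro P_position_plusI) (auto simp: opt)
    moreover have "\<not> P_position (H + T)"
      using X False by (intro not_P_position_plusI2[of X]) (auto simp: opt)
    ultimately show ?thesis
      by blast
  qed
qed

text \<open>
  This is the nontrivial half of Conway's linking theorem, in contrapositive form. If \<open>H\<close>
  differs from all options of \<open>G\<close>, and \<open>G\<close> from those of \<open>H\<close>, then the witnesses of these
  differences can be collected into a single game \<open>T\<close> that makes both sums
  \<open>\<P>\<close>-positions.
\<close>

lemma linked_cases:
  assumes "\<And>T. \<not> (P_position (G + T) \<and> P_position (H + T))"
  obtains G' where "G' |\<in>| options G" "G' \<doteq> H"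
    | H' where "H' |\<in>| options H" "H' \<doteq> G"
proof -
  have False
    if G: "\<forall>G' |\<in>| options G. \<not> G' \<doteq> H" and H: "\<forall>H' |\<in>| options H. \<not> H' \<doteq> G"
  proof (cases "G = 0 \<and> H = 0")
    case True
    then show False
      using assms ex_mate[of 0] by blast
  next
    case False
    have "\<forall>G' |\<in>| options G. \<exists>X. P_position (G' + X) \<and> \<not> P_position (H + X)"
      using G distinguishing_game by blast
    then obtain x where x: "\<And>G'. G' |\<in>| options G \<Longrightarrow> P_position (G' + x G') \<and> \<not> P_position (H + x G')"
      by metis
    have "\<forall>H' |\<in>| options H. \<exists>Y. P_position (H' + Y) \<and> \<not> P_position (G + Y)"
      using H distinguishing_game by blast
    then obtain y where y: "\<And>H'. H' |\<in>| options H \<Longrightarrow> P_position (H' + y H') \<and> \<not> P_position (G + y H')"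
      by metis
    define T where "T = Game (x |`| options G |\<union>| y |`| options H)"
    have opt: "options T = x |`| options G |\<union>| y |`| options H"
      by (simp add: T_def)
    then have "T \<noteq> 0"
      using False by (simp flip: options_eq_empty_iff)
    have "\<not> P_position (G + x G')" if "G' |\<in>| options G" for G'
      using that x not_P_position_plusI1 by blast
    then have PG: "P_position (G + T)"
      using \<open>T \<noteq> 0\<close> x y by (intro P_position_plusI) (auto simp: opt)
    have "\<not> P_position (H + y H')" if "H' |\<in>| options H" for H'
      using that y not_P_position_plusI1 by blast
    then have PH: "P_position (H + T)"
      using \<open>T \<noteq> 0\<close> x y by (intro P_position_plusI) (auto simp: opt)
    show False
      using assms PG PH by blast
  qed
  then show thesis
    using that by blast
qed

text \<open>
  A game equal to \<open>H\<close> cannot be linked to an option \<open>H'\<close> of \<open>H\<close>: from the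
  \<open>\<P>\<close>-position \<open>H + T\<close> there is no move to a \<open>\<P>\<close>-position \<open>H' + T\<close>.
\<close>

lemma game_eq_option_cases:
  assumes "G \<doteq> H" "H' |\<in>| options H"
  obtains G' where "G' |\<in>| options G" "G' \<doteq> H'"
    | H'' where "H'' |\<in>| options H'" "H'' \<doteq> G"
proof (rule linked_cases[of G H'])
  show "\<not> (P_position (G + T) \<and> P_position (H' + T))" for T
    using assms not_P_position_plusI1[of H' H T] by (auto simp: game_eq_def)
qed (use that in blast)+

section \<open>Simplest forms\<close>

lemma simplest_form_option:
  assumes "simplest_form G" "G' |\<in>| options G"
  shows "simplest_form G'"
  using assms unfolding simplest_form_def reachable_def
  by (blast intro: converse_rtranclp_into_rtranclp)

lemma simplest_form_iff:
  "simplest_form G \<longleftrightarrow>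
     (\<nexists>G'. reversible_option G G') \<and> (\<forall>G' |\<in>| options G. simplest_form G')"
  unfolding simplest_form_def reachable_def
  by (blast intro: converse_rtranclp_into_rtranclp elim: converse_rtranclpE)

text \<open>
  No option can reverse, so the options of either game are matched, up to equality, by
  options of the other.
\<close>

lemma simplest_form_unique:
  "G \<doteq> H \<Longrightarrow> simplest_form G \<Longrightarrow> simplest_form H \<Longrightarrow> G = H"
proof (induction G arbitrary: H rule: game_option_induct)
  case (option G)
  have norev: "\<not> K'' \<doteq> K" if "simplest_form K" "K' |\<in>| options K" "K'' |\<in>| options K'" for K K' K''
    using that unfolding simplest_form_iff[of K] reversible_option_def by blast
  have "H' |\<in>| options G" if "H' |\<in>| options H" for H'
    using option.prems(1) that
  proof (cases rule: game_eq_option_cases)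
    case (1 G')
    then show ?thesis
      using option.IH[of G' H'] option.prems that simplest_form_option by blast
  next
    case (2 H'')
    then show ?thesis
      using norev option.prems that game_eq_trans by blast
  qed
  moreover have "G' |\<in>| options H" if "G' |\<in>| options G" for G'
    using game_eq_sym[OF option.prems(1)] that
  proof (cases rule: game_eq_option_cases)
    case (1 H')
    then show ?thesis
      using option.IH[of G' H'] option.prems that simplest_form_option game_eq_sym by blast
  next
    case (2 G'')
    then show ?thesis
      using norev option.prems that game_eq_trans game_eq_sym by blast
  qed
  ultimately have "options G = options H"
    by blast
  then show ?case
    by (simp add: game.expand)
qed

lemma simplifies_game_eq:
  assumes "simplifies H G"
  shows "H \<doteq> G"
proof -
  have sub: "\<And>G'. G' |\<in>| options G \<Longrightarrow> G' |\<in>| options H" and "options H \<noteq> {||}"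
    and rev: "\<And>H'. H' |\<in>| options H \<Longrightarrow> H' |\<notin>| options G \<Longrightarrow> G |\<in>| options H'"
    and zero: "G = 0 \<Longrightarrow> \<not> P_position H"
    using assms by (auto simp: simplifies_def N_position_def simp del: options_eq_empty_iff)
  then have "H \<noteq> 0"
    by simp
  have "P_position (H + X) \<longleftrightarrow> P_position (G + X)" for X
  proof (induction X rule: game_option_induct)
    case (option X)
    show ?case
    proof
      assume P: "P_position (H + X)"
      \<comment> \<open>The proviso on \<open>0\<close> matters only here, where \<open>G + X\<close> must have a move.\<close>
      have "G \<noteq> 0 \<or> X \<noteq> 0"
        using P zero by auto
      then show "P_position (G + X)"
        using P sub option unfolding P_position_plus_iff[of G X] P_position_plus_iff[of H X] by blast
    next
      assume P: "P_position (G + X)"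
      \<comment> \<open>A move to one of the additional options is answered by the move back to \<open>G\<close>.\<close>
      have "\<not> P_position (H' + X)" if "H' |\<in>| options H" for H'
        using P rev[OF that] not_P_position_plusI1 by blast
      then show "P_position (H + X)"
        using P \<open>H \<noteq> 0\<close> option unfolding P_position_plus_iff[of G X] P_position_plus_iff[of H X] by blast
    qed
  qed
  then show ?thesis
    by (simp add: game_eq_def)
qed

text \<open>
  The link between the algebra of equality and the counting: a game whose options are in
  simplest form fails to be so itself exactly by simplifying to a smaller game. The witness
  is the \<open>H''\<close> of a reversible option, which is already in simplest form.
\<close>

lemma not_simplest_form_iff_simplifies:
  assumes opt: "\<And>H'. H' |\<in>| options H \<Longrightarrow> simplest_form H'"
  shows "\<not> simplest_form H \<longleftrightarrow> (\<exists>G. simplest_form G \<and> simplifies H G)"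
proof
  assume "\<not> simplest_form H"
  then obtain H' G where H': "H' |\<in>| options H" "G |\<in>| options H'" and eq: "G \<doteq> H"
    using opt unfolding simplest_form_iff[of H] reversible_option_def by blast
  have G: "simplest_form G"
    using H' opt simplest_form_option by blast
  have "G' |\<in>| options H" if G': "G' |\<in>| options G" for G'
    using game_eq_sym[OF eq] G'
  proof (cases rule: game_eq_option_cases)
    case (1 K)
    then show ?thesis
      using simplest_form_unique[of K G'] opt simplest_form_option[OF G G'] by blast
  next
    case (2 G'')
    then have "reversible_option G G'"
      using G' eq game_eq_sym game_eq_trans unfolding reversible_option_def by blast
    then show ?thesis
      using G simplest_form_iff by blast
  qed
  moreover have "G |\<in>| options K" if K: "K |\<in>| options H" "K |\<notin>| options G" for K
    using eq K(1)
  proof (cases rule: game_eq_option_cases)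
    case (1 G')
    then show ?thesis
      using simplest_form_unique[of G' K] opt K simplest_form_option[OF G] by blast
  next
    case (2 K')
    then show ?thesis
      using simplest_form_unique[of K' G] opt K G simplest_form_option by blast
  qed
  moreover have "options G \<noteq> options H"
    using H' option_asym by blast
  moreover have "G = 0 \<longrightarrow> N_position H"
    using game_eq_P_position[OF eq] by (auto simp: N_position_def P_position_iff[of 0])
  ultimately have "simplifies H G"
    unfolding simplifies_def by blast
  then show "\<exists>G. simplest_form G \<and> simplifies H G"
    using G by blast
next
  assume "\<exists>G. simplest_form G \<and> simplifies H G"
  then obtain G where G: "simplest_form G" "simplifies H G"
    by blast
  then have "options G |\<subset>| options H"
    by (simp add: simplifies_def)
  then have "G \<noteq> H"
    by auto
  then show "\<not> simplest_form H"
    using simplest_form_unique[of H G] simplifies_game_eq G by blast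
qed

section \<open>Birthdays\<close>

lemma fMax_le_iff:
  assumes "A \<noteq> {||}"
  shows "fMax A \<le> n \<longleftrightarrow> (\<forall>a |\<in>| A. a \<le> n)"
  using fMax_in[OF assms] fMax_ge[of _ A] order_trans by blast

lemma formal_birthday_le_iff:
  "formal_birthday G \<le> n \<longleftrightarrow> (\<forall>G' |\<in>| options G. formal_birthday G' < n)"
proof (cases "G = 0")
  case True
  then show ?thesis
    by (subst formal_birthday.simps) simp
next
  case False
  then show ?thesis
    by (subst formal_birthday.simps) (simp add: fMax_le_iff Suc_le_eq)
qed

lemma formal_birthday_option:
  "G' |\<in>| options G \<Longrightarrow> formal_birthday G' < formal_birthday G"
  using formal_birthday_le_iff by blast

text \<open>
  Once the options are in simplest form, a reversible option offers an equal game that is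
  in simplest form and was born earlier.
\<close>

lemma ex_simplest_form:
  "\<exists>H. H \<doteq> G \<and> simplest_form H \<and> formal_birthday H \<le> formal_birthday G"
proof (induction G rule: game_option_induct)
  case (option G)
  then obtain s where s: "\<And>G'. G' |\<in>| options G \<Longrightarrow>
      s G' \<doteq> G' \<and> simplest_form (s G') \<and> formal_birthday (s G') \<le> formal_birthday G'"
    by metis
  define H where "H = Game (s |`| options G)"
  have eq: "H \<doteq> G"
    unfolding H_def using s by (intro game_eq_replace_each_option) blast
  have opt: "simplest_form H'" if "H' |\<in>| options H" for H'
    using that s by (auto simp: H_def)
  have "formal_birthday (s G') < formal_birthday G" if "G' |\<in>| options G" for G'
    using s[OF that] formal_birthday_option[OF that] by simp
  then have fb: "formal_birthday H \<le> formal_birthday G"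
    by (simp add: H_def formal_birthday_le_iff[of "Game (s |`| options G)"])
  show ?case
  proof (cases "simplest_form H")
    case True
    then show ?thesis
      using eq fb by blast
  next
    case False
    then obtain H' H'' where "H' |\<in>| options H" "H'' |\<in>| options H'" "H'' \<doteq> H"
      using opt unfolding simplest_form_iff[of H] reversible_option_def by blast
    moreover from this have "formal_birthday H'' \<le> formal_birthday G"
      using formal_birthday_option[of H'' H'] formal_birthday_option[of H' H] fb by simp
    ultimately show ?thesis
      using opt simplest_form_option eq game_eq_trans by blast
  qed
qed

lemma birthday_simplest_form:
  assumes "simplest_form G"
  shows "birthday G = formal_birthday G"
  unfolding birthday_def
proof (rule Least_equality)
  fix k
  assume "\<exists>H. H \<doteq> G \<and> formal_birthday H = k"
  then obtain H where "H \<doteq> G" "formal_birthday H = k"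
    by blast
  moreover obtain K where K: "K \<doteq> H" "simplest_form K" "formal_birthday K \<le> formal_birthday H"
    using ex_simplest_form by blast
  ultimately show "formal_birthday G \<le> k"
    using simplest_form_unique[of K G] assms game_eq_trans by blast
qed (use game_eq_refl in blast)

lemma M_eq: "M n = {G. simplest_form G \<and> formal_birthday G \<le> n}"
  by (auto simp: M_def game_values_def birthday_simplest_form)

lemma M_option: "G \<in> M n \<Longrightarrow> G' |\<in>| options G \<Longrightarrow> G' \<in> M (n - 1)"
  using simplest_form_option[of G G'] formal_birthday_option[of G' G] by (auto simp: M_eq)

lemma M_mono: "m \<le> n \<Longrightarrow> M m \<subseteq> M n"
  by (auto simp: M_eq)

lemma zero_in_M: "0 \<in> M n"
  by (auto simp: M_eq simplest_form_iff[of 0] reversible_option_def formal_birthday.simps[of 0])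

section \<open>Games with prescribed options\<close>

definition games_between :: "game set \<Rightarrow> game set \<Rightarrow> game set" where
  "games_between B A = {H. B \<subseteq> fset (options H) \<and> fset (options H) \<subseteq> A}"

lemma bij_betw_games_between:
  assumes "finite A" "B \<subseteq> A"
  shows "bij_betw (\<lambda>H. fset (options H) - B) (games_between B A) (Pow (A - B))"
proof (rule bij_betw_byWitness[where f' = "\<lambda>X. Game (Abs_fset (X \<union> B))"])
  have fset_Abs: "fset (Abs_fset (X \<union> B)) = X \<union> B" if "X \<subseteq> A - B" for X
  proof -
    have "finite (X \<union> B)"
      by (rule finite_subset[OF _ assms(1)]) (use that assms(2) in blast)
    then show ?thesis
      by (simp add: Abs_fset_inverse)
  qed
  show "\<forall>H \<in> games_between B A. Game (Abs_fset (fset (options H) - B \<union> B)) = H"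
  proof
    fix H
    assume "H \<in> games_between B A"
    then have "fset (options H) - B \<union> B = fset (options H)"
      unfolding games_between_def by blast
    then show "Game (Abs_fset (fset (options H) - B \<union> B)) = H"
      by (simp add: fset_inverse)
  qed
  show "\<forall>X \<in> Pow (A - B). fset (options (Game (Abs_fset (X \<union> B)))) - B = X"
  proof
    fix X
    assume "X \<in> Pow (A - B)"
    then show "fset (options (Game (Abs_fset (X \<union> B)))) - B = X"
      using fset_Abs[of X] by auto
  qed
  show "(\<lambda>H. fset (options H) - B) ` games_between B A \<subseteq> Pow (A - B)"
    unfolding games_between_def by blast
  show "(\<lambda>X. Game (Abs_fset (X \<union> B))) ` Pow (A - B) \<subseteq> games_between B A"
  proof
    fix H
    assume "H \<in> (\<lambda>X. Game (Abs_fset (X \<union> B))) ` Pow (A - B)"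
    then obtain X where "X \<subseteq> A - B" "H = Game (Abs_fset (X \<union> B))"
      by blast
    then show "H \<in> games_between B A"
      using fset_Abs[of X] assms(2) by (auto simp: games_between_def)
  qed
qed

lemma finite_games_between:
  assumes "finite A"
  shows "finite (games_between B A)"
proof (rule finite_subset)
  show "games_between B A \<subseteq> games_between {} A"
    by (auto simp: games_between_def)
  show "finite (games_between {} A)"
    using bij_betw_finite[OF bij_betw_games_between[OF assms, of "{}"]] assms by simp
qed

lemma card_games_between:
  assumes "finite A" "B \<subseteq> A"
  shows "card (games_between B A) = 2 ^ (card A - card B)"
  using bij_betw_same_card[OF bij_betw_games_between[OF assms]] assms
  by (simp add: card_Pow card_Diff_subset finite_subset[OF assms(2,1)])

lemma M_Suc: "M (Suc n) = {H \<in> games_between {} (M n). simplest_form H}"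
  by (auto simp: M_eq games_between_def formal_birthday_le_iff[of _ "Suc n"] less_Suc_eq_le
    subset_iff dest: simplest_form_option)

lemma finite_M: "finite (M n)"
proof (induction n)
  case 0
  have "M 0 \<subseteq> {0}"
    using formal_birthday_le_iff[of _ 0] by (auto simp: M_eq)
  then show ?case
    using finite_subset by blast
next
  case (Suc n)
  then show ?case
    unfolding M_Suc using finite_games_between by simp
qed

lemma finite_S: "finite (S n K)"
  by (simp add: S_def finite_M)

section \<open>The recurrences\<close>

lemma simplifies_iff:
  "simplifies H G \<longleftrightarrow>
     fset (options G) \<subseteq> fset (options H) \<and> H \<noteq> G
     \<and> (\<forall>H' |\<in>| options H. H' |\<notin>| options G \<longrightarrow> G |\<in>| options H')
     \<and> (G = 0 \<longrightarrow> N_position H)"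
proof -
  have "options G = options H \<longleftrightarrow> H = G"
    by (auto intro: game.expand)
  then have "options G |\<subset>| options H \<longleftrightarrow> fset (options G) \<subseteq> fset (options H) \<and> H \<noteq> G"
    by (auto simp: order.strict_iff_order less_eq_fset.rep_eq)
  then show ?thesis
    unfolding simplifies_def by auto
qed

lemma R_eq:
  assumes "n \<ge> 1"
  shows "R n G = {H \<in> games_between {} (M (n - 1)). simplifies H G}"
proof -
  have "{H' \<in> game_values. birthday H' < n} = M (n - 1)"
    using assms by (auto simp: M_def)
  then show ?thesis
    by (simp add: R_def games_between_def)
qed

lemma finite_R: "n \<ge> 1 \<Longrightarrow> finite (R n G)"
  by (simp add: R_eq finite_games_between finite_M)

lemma R_game_eq: "H \<in> R n G \<Longrightarrow> H \<doteq> G"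
  by (simp add: R_def simplifies_game_eq)

lemma R_nonempty_imp_M:
  assumes "n \<ge> 2" "H \<in> R n G"
  shows "G \<in> M (n - 2)"
proof -
  have H: "fset (options H) \<subseteq> M (n - 1)" "simplifies H G"
    using assms by (auto simp: R_eq games_between_def)
  then obtain H' where "H' |\<in>| options H" "G |\<in>| options H'"
    unfolding simplifies_def by blast
  then have "G \<in> M (n - 1 - 1)"
    using H M_option[of H' "n - 1" G] by blast
  then show ?thesis
    by (simp add: numeral_2_eq_2)
qed

text \<open>
  The common source of the four recurrences that sum over \<open>M (n - 2)\<close> or a part of it. The
  sets \<open>R n G\<close> are disjoint because equal games in simplest form are identical.
\<close>

lemma card_M_filter:
  assumes "n \<ge> 2"
  shows "int (card {H \<in> M n. Q H}) =
    int (card {H \<in> games_between {} (M (n - 1)). Q H})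
    - (\<Sum>G\<in>M (n - 2). int (card {H \<in> R n G. Q H}))"
proof -
  let ?U = "games_between {} (M (n - 1))"
  let ?R = "\<lambda>G. {H \<in> R n G. Q H}"
  have n: "Suc (n - 1) = n" "n \<ge> 1"
    using assms by auto
  have M: "M n = {H \<in> ?U. simplest_form H}"
    using M_Suc[of "n - 1"] n by simp
  have nsf: "\<not> simplest_form H \<longleftrightarrow> (\<exists>G \<in> M (n - 2). H \<in> R n G)" if H: "H \<in> ?U" for H
  proof -
    have "\<not> simplest_form H \<longleftrightarrow> (\<exists>G. simplest_form G \<and> simplifies H G)"
      by (rule not_simplest_form_iff_simplifies) (use H in \<open>auto simp: games_between_def M_eq\<close>)
    also have "\<dots> \<longleftrightarrow> (\<exists>G. simplest_form G \<and> H \<in> R n G)"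
      using H n by (simp add: R_eq)
    also have "\<dots> \<longleftrightarrow> (\<exists>G \<in> M (n - 2). H \<in> R n G)"
      using R_nonempty_imp_M[OF assms, of H] by (auto simp: M_eq)
    finally show ?thesis .
  qed
  have U: "{H \<in> ?U. Q H} = {H \<in> M n. Q H} \<union> (\<Union>G\<in>M (n - 2). ?R G)"
  proof -
    have "?R G \<subseteq> ?U" for G
      using n by (auto simp: R_eq)
    then show ?thesis
      using nsf unfolding M by blast
  qed
  have disj: "{H \<in> M n. Q H} \<inter> (\<Union>G\<in>M (n - 2). ?R G) = {}"
    using nsf unfolding M by blast
  have fin: "finite (?R G)" for G
    using finite_R n by simp
  have "?R G \<inter> ?R G' = {}" if "G \<in> M (n - 2)" "G' \<in> M (n - 2)" "G \<noteq> G'" for G G'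
  proof (rule ccontr)
    assume "?R G \<inter> ?R G' \<noteq> {}"
    then obtain H where "H \<in> R n G" "H \<in> R n G'"
      by blast
    then have "H \<doteq> G" "H \<doteq> G'"
      by (simp_all add: R_game_eq)
    then have "G \<doteq> G'"
      by (blast intro: game_eq_sym game_eq_trans)
    then show False
      using that simplest_form_unique[of G G'] by (simp add: M_eq)
  qed
  then have "card (\<Union>G\<in>M (n - 2). ?R G) = (\<Sum>G\<in>M (n - 2). card (?R G))"
    by (intro card_UN_disjoint) (auto simp: finite_M fin)
  moreover have "card {H \<in> ?U. Q H} = card {H \<in> M n. Q H} + card (\<Union>G\<in>M (n - 2). ?R G)"
    unfolding U by (rule card_Un_disjoint[OF _ _ disj]) (auto simp: finite_M fin)
  ultimately show ?thesis
    by simp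
qed

text \<open>
  The empty option set is the one exception to the rule that a game with \<open>\<N>\<close>-positions as
  its only options is a \<open>\<P>\<close>-position.
\<close>

lemma N_games_between:
  "{H \<in> games_between B A. N_position H} =
     games_between B A - (games_between B {H \<in> A. N_position H} - {0})"
proof -
  have "N_position H \<longleftrightarrow> H = 0 \<or> (\<exists>H' |\<in>| options H. \<not> N_position H')" for H
    unfolding N_position_def using P_position_iff[of H] by blast
  then show ?thesis
    unfolding games_between_def by blast
qed

lemma options_disjoint_S: "fset (options G) \<inter> S n G = {}"
  using option_asym by (auto simp: S_def)

lemma R_nonzero:
  assumes "n \<ge> 2" "G \<in> M (n - 2)" "G \<noteq> 0"
  shows "R n G = games_between (fset (options G)) (fset (options G) \<union> S (n - 1) G) - {G}"
proof -
  have "fset (options G) \<subseteq> M (n - 1)"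
    using M_option[OF assms(2)] M_mono[of "n - 2 - 1" "n - 1"] by (simp add: subset_iff)
  moreover have "R n G = {H. fset (options H) \<subseteq> M (n - 1) \<and> simplifies H G}"
    using assms(1) by (simp add: R_eq games_between_def)
  moreover have "H \<in> games_between (fset (options G)) (fset (options G) \<union> S (n - 1) G) - {G}
    \<longleftrightarrow> fset (options H) \<subseteq> M (n - 1) \<and> simplifies H G"
    if "fset (options G) \<subseteq> M (n - 1)" for H
    using that assms(3) by (auto simp: games_between_def simplifies_iff S_def subset_iff)
  ultimately show ?thesis
    by blast
qed

text \<open>
  The additional options are those having \<open>0\<close> as an option, and such an option is an
  \<open>\<N>\<close>-position exactly if it lies in \<open>N0 (n - 1)\<close>. Removing all sets of these removes
  the \<open>\<P>\<close>-positions and, with the empty set, \<open>0\<close> itself.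
\<close>

lemma R_zero:
  assumes "n \<ge> 1"
  shows "R n 0 = games_between {} (S (n - 1) 0) - games_between {} (N0 (n - 1))"
proof -
  have "R n 0 = {H \<in> games_between {} (S (n - 1) 0). N_position H} - {0}"
    using assms by (auto simp: R_eq games_between_def simplifies_iff S_def)
  also have "\<dots> = games_between {} (S (n - 1) 0) - games_between {} {H \<in> S (n - 1) 0. N_position H}"
    unfolding N_games_between by (auto simp: games_between_def)
  also have "{H \<in> S (n - 1) 0. N_position H} = N0 (n - 1)"
    by (auto simp: S_def N0_def)
  finally show ?thesis .
qed

lemma games_between_insert:
  "{H \<in> games_between B A. K |\<in>| options H} = games_between (insert K B) A"
  by (auto simp: games_between_def)

lemma card_games_between_Diff:
  assumes "finite A" "B \<subseteq> C" "C \<subseteq> A"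
  shows "int (card (games_between B A - games_between B C)) =
    2 ^ (card A - card B) - 2 ^ (card C - card B)"
proof -
  have C: "finite C"
    using assms finite_subset by blast
  have sub: "games_between B C \<subseteq> games_between B A"
    using assms by (auto simp: games_between_def)
  have "card (games_between B C) \<le> card (games_between B A)"
    by (rule card_mono[OF finite_games_between[OF assms(1)] sub])
  then show ?thesis
    using card_games_between[OF assms(1), of B] card_games_between[OF C assms(2)] assms
    by (simp add: card_Diff_subset[OF finite_games_between[OF C] sub] of_nat_diff)
qed

lemma card_R:
  assumes "n \<ge> 2"
  shows "int (card (R n G)) =
    (if G \<noteq> 0 then 2 ^ card (S (n - 1) G) - 1
     else 2 ^ card (S (n - 1) G) - 2 ^ card (N0 (n - 1)))"
proof (cases "G = 0")
  case True
  have "N0 (n - 1) \<subseteq> S (n - 1) 0"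
    by (auto simp: N0_def S_def)
  then show ?thesis
    using True assms card_games_between_Diff[OF finite_S, of "{}"] by (simp add: R_zero)
next
  case False
  show ?thesis
  proof (cases "G \<in> M (n - 2)")
    case True
    let ?O = "fset (options G)" and ?S = "S (n - 1) G"
    have "card (?O \<union> ?S) = card ?O + card ?S"
      by (rule card_Un_disjoint) (auto simp: finite_S options_disjoint_S)
    then have "card (games_between ?O (?O \<union> ?S)) = 2 ^ card ?S"
      by (subst card_games_between) (auto simp: finite_S)
    moreover have "G \<in> games_between ?O (?O \<union> ?S)"
      by (auto simp: games_between_def)
    ultimately show ?thesis
      using False by (simp add: R_nonzero[OF assms True False] card_Diff_singleton of_nat_diff)
  next
    \<comment> \<open>Neither \<open>R n G\<close> nor \<open>S (n - 1) G\<close> has elements when \<open>G\<close> is born too late.\<close>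
    case G: False
    have "R n G = {}"
      using R_nonempty_imp_M[OF assms] G by blast
    moreover have "S (n - 1) G = {}"
      using M_option[of _ "n - 1" G] G by (auto simp: S_def numeral_2_eq_2)
    ultimately show ?thesis
      using False by simp
  qed
qed

lemma card_RK:
  assumes "n \<ge> 2" "K \<in> M (n - 1)" "G |\<in>| options K"
  shows "int (card (RK n G K)) =
    (if G \<noteq> 0 \<or> P_position K then 2 ^ (card (S (n - 1) G) - 1)
     else 2 ^ (card (S (n - 1) G) - 1) - 2 ^ (card (N0 (n - 1)) - 1))"
proof (cases "G = 0")
  case True
  let ?S = "S (n - 1) 0" and ?N0 = "N0 (n - 1)"
  have N0: "?N0 \<subseteq> ?S"
    by (auto simp: N0_def S_def)
  have K: "K \<in> ?S"
    using assms True by (simp add: S_def)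
  have RK: "RK n G K = games_between {K} ?S - games_between {K} ?N0"
    using assms True by (auto simp: RK_def R_zero games_between_def)
  show ?thesis
  proof (cases "P_position K")
    case True
    then have "games_between {K} ?N0 = {}"
      by (auto simp: games_between_def N0_def N_position_def)
    then show ?thesis
      using True K RK card_games_between[of ?S "{K}"] \<open>G = 0\<close> by (simp add: finite_S)
  next
    case False
    then have "K \<in> ?N0"
      using K by (simp add: N0_def S_def N_position_def)
    then show ?thesis
      using False RK card_games_between_Diff[OF finite_S, of "{K}" ?N0] N0 \<open>G = 0\<close> by simp
  qed
next
  case False
  let ?O = "fset (options G)" and ?S = "S (n - 1) G"
  have G: "G \<in> M (n - 2)"
    using M_option[OF assms(2,3)] by (simp add: numeral_2_eq_2)
  have K: "K \<in> ?S" "K \<notin> ?O"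
    using assms option_asym by (auto simp: S_def)
  have "RK n G K = games_between (insert K ?O) (?O \<union> ?S)"
    using K R_nonzero[OF assms(1) G False]
    by (auto simp: RK_def games_between_def)
  moreover have "card (?O \<union> ?S) = card ?O + card ?S"
    by (rule card_Un_disjoint) (auto simp: finite_S options_disjoint_S)
  ultimately have "card (RK n G K) = 2 ^ (card ?S - 1)"
    using K by (subst \<open>RK n G K = _\<close>, subst card_games_between) (auto simp: finite_S)
  then show ?thesis
    using False by simp
qed

lemma card_M:
  assumes "n \<ge> 2"
  shows "int (card (M n)) = 2 ^ card (M (n - 1)) - (\<Sum>G\<in>M (n - 2). int (card (R n G)))"
  using card_M_filter[OF assms, of "\<lambda>_. True"] card_games_between[OF finite_M, of "{}"] by simp

lemma sum_card_filter_eq: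
  assumes "finite A" "\<And>G. G \<in> A \<Longrightarrow> \<not> P G \<Longrightarrow> f G = {}"
  shows "(\<Sum>G\<in>A. int (card (f G))) = (\<Sum>G\<in>{G \<in> A. P G}. int (card (f G)))"
  using assms by (intro sum.mono_neutral_right) auto

lemma card_S:
  assumes "n \<ge> 2" "K \<in> M (n - 1)"
  shows "int (card (S n K)) =
    2 ^ (card (M (n - 1)) - 1)
    - (\<Sum>G\<in>fset (options K). int (card (RK n G K)))
    - (\<Sum>G\<in>S (n - 2) K. int (card (R n G)))"
proof -
  let ?RK = "\<lambda>G. int (card (RK n G K))"
  have O: "fset (options K) \<subseteq> M (n - 2)"
    using M_option[OF assms(2)] by (auto simp: numeral_2_eq_2)
  have mem: "K |\<in>| options H" if "H \<in> R n G" "K |\<in>| options G" for G H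
    using that by (auto simp: R_def simplifies_def)
  \<comment> \<open>An option \<open>K\<close> of \<open>H\<close> is an option of \<open>G\<close> or one of the additional ones, which
    have \<open>G\<close> as an option.\<close>
  have empty: "RK n G K = {}" if "G \<in> M (n - 2)" "G \<notin> fset (options K) \<union> S (n - 2) K" for G
    using that by (auto simp: RK_def R_def simplifies_def S_def)
  have "int (card (S n K)) =
      int (card (games_between {K} (M (n - 1)))) - (\<Sum>G\<in>M (n - 2). ?RK G)"
    using card_M_filter[OF assms(1), of "\<lambda>H. K |\<in>| options H"]
    by (simp add: S_def RK_def games_between_insert)
  also have "card (games_between {K} (M (n - 1))) = 2 ^ (card (M (n - 1)) - 1)"
    using assms(2) by (simp add: card_games_between finite_M)
  also have "(\<Sum>G\<in>M (n - 2). ?RK G) = (\<Sum>G\<in>fset (options K) \<union> S (n - 2) K. ?RK G)"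
    using empty O by (intro sum.mono_neutral_right) (auto simp: finite_M S_def)
  also have "\<dots> = (\<Sum>G\<in>fset (options K). ?RK G) + (\<Sum>G\<in>S (n - 2) K. ?RK G)"
    by (rule sum.union_disjoint) (simp_all add: finite_S options_disjoint_S)
  also have "(\<Sum>G\<in>S (n - 2) K. ?RK G) = (\<Sum>G\<in>S (n - 2) K. int (card (R n G)))"
  proof (rule sum.cong)
    fix G
    assume "G \<in> S (n - 2) K"
    then have "RK n G K = R n G"
      using mem by (auto simp: RK_def S_def)
    then show "?RK G = int (card (R n G))"
      by simp
  qed simp
  finally show ?thesis
    by simp
qed

lemma R_N_position:
  "H \<in> R n G \<Longrightarrow> N_position H \<longleftrightarrow> N_position G"
  unfolding N_position_def using R_game_eq game_eq_P_position by blast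

lemma card_N:
  assumes "n \<ge> 2"
  shows "int (card (N n)) =
    2 ^ card (M (n - 1)) - 2 ^ card (N (n - 1)) + 1
    - (\<Sum>G\<in>N (n - 2). int (card (R n G)))"
proof -
  let ?U = "games_between {} (M (n - 1))" and ?V = "games_between {} (N (n - 1))"
  have "(\<Sum>G\<in>M (n - 2). int (card {H \<in> R n G. N_position H}))
      = (\<Sum>G\<in>N (n - 2). int (card {H \<in> R n G. N_position H}))"
    unfolding N_def
    by (rule sum_card_filter_eq) (use R_N_position in \<open>auto simp: finite_M\<close>)
  also have "\<dots> = (\<Sum>G\<in>N (n - 2). int (card (R n G)))"
  proof (rule sum.cong)
    fix G
    assume "G \<in> N (n - 2)"
    then have "{H \<in> R n G. N_position H} = R n G"
      using R_N_position by (auto simp: N_def)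
    then show "int (card {H \<in> R n G. N_position H}) = int (card (R n G))"
      by simp
  qed simp
  finally have sum: "(\<Sum>G\<in>M (n - 2). int (card {H \<in> R n G. N_position H}))
      = (\<Sum>G\<in>N (n - 2). int (card (R n G)))" .
  have "{H \<in> ?U. N_position H} = (?U - ?V) \<union> {0}"
    unfolding N_games_between N_def by (auto simp: games_between_def)
  moreover have "0 \<notin> ?U - ?V"
    by (auto simp: games_between_def)
  ultimately have "card {H \<in> ?U. N_position H} = card (?U - ?V) + 1"
    by (simp add: finite_games_between finite_M)
  moreover have "int (card (?U - ?V)) = 2 ^ card (M (n - 1)) - 2 ^ card (N (n - 1))"
    using card_games_between_Diff[OF finite_M, of "{}" "N (n - 1)"] by (auto simp: N_def)
  ultimately show ?thesis
    using card_M_filter[OF assms, of N_position] sum by (simp add: N_def)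
qed

lemma card_N0:
  assumes "n \<ge> 2"
  shows "int (card (N0 n)) =
    2 ^ (card (M (n - 1)) - 1) - 2 ^ (card (N (n - 1)) - 1)
    - (\<Sum>G\<in>N0 (n - 2). int (card (R n G)))"
proof -
  let ?Q = "\<lambda>H. N_position H \<and> 0 |\<in>| options H"
  let ?U = "games_between {0} (M (n - 1))" and ?V = "games_between {0} (N (n - 1))"
  \<comment> \<open>\<open>0\<close> has no options, so it is never one of the additional options of \<open>H\<close>.\<close>
  have "0 |\<in>| options H \<longleftrightarrow> 0 |\<in>| options G" if "H \<in> R n G" for H G
  proof -
    have "fset (options G) \<subseteq> fset (options H)"
      and "0 |\<in>| options H \<Longrightarrow> 0 |\<notin>| options G \<Longrightarrow> G |\<in>| options 0"
      using that by (auto simp: R_def simplifies_iff)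
    then show ?thesis
      by auto
  qed
  then have Q: "?Q H \<longleftrightarrow> ?Q G" if "H \<in> R n G" for H G
    using that R_N_position by blast
  have "(\<Sum>G\<in>M (n - 2). int (card {H \<in> R n G. ?Q H}))
      = (\<Sum>G\<in>N0 (n - 2). int (card {H \<in> R n G. ?Q H}))"
    unfolding N0_def by (rule sum_card_filter_eq[OF finite_M]) (use Q in blast)
  also have "\<dots> = (\<Sum>G\<in>N0 (n - 2). int (card (R n G)))"
  proof (rule sum.cong)
    fix G
    assume "G \<in> N0 (n - 2)"
    then have "{H \<in> R n G. ?Q H} = R n G"
      using Q unfolding N0_def by blast
    then show "int (card {H \<in> R n G. ?Q H}) = int (card (R n G))"
      by simp
  qed simp
  finally have sum: "(\<Sum>G\<in>M (n - 2). int (card {H \<in> R n G. ?Q H}))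
      = (\<Sum>G\<in>N0 (n - 2). int (card (R n G)))" .
  have "{H \<in> games_between {} (M (n - 1)). ?Q H} = {H \<in> ?U. N_position H}"
    by (auto simp: games_between_def)
  also have "\<dots> = ?U - ?V"
    unfolding N_games_between N_def by (auto simp: games_between_def)
  finally have "{H \<in> games_between {} (M (n - 1)). ?Q H} = ?U - ?V" .
  moreover have "0 \<in> N (n - 1)"
    using zero_in_M by (auto simp: N_def N_position_def P_position_iff[of 0])
  then have "int (card (?U - ?V)) = 2 ^ (card (M (n - 1)) - 1) - 2 ^ (card (N (n - 1)) - 1)"
    using card_games_between_Diff[OF finite_M, of "{0}" "N (n - 1)"] by (auto simp: N_def)
  ultimately show ?thesis
    using card_M_filter[OF assms, of ?Q] sum by (simp add: N0_def)
qed

theorem theoremA1: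
  fixes n :: nat
  assumes "n \<ge> 2"
  shows
    "int (card (M n)) = 2 ^ card (M (n - 1)) - (\<Sum>G\<in>M (n - 2). int (card (R n G)))
     \<and> (\<forall>G\<in>game_values. int (card (R n G)) =
           (if G \<noteq> 0 then 2 ^ card (S (n - 1) G) - 1
            else 2 ^ card (S (n - 1) G) - 2 ^ card (N0 (n - 1))))
     \<and> (\<forall>K\<in>M (n - 1). int (card (S n K)) =
           2 ^ (card (M (n - 1)) - 1)
           - (\<Sum>G\<in>fset (options K). int (card (RK n G K)))
           - (\<Sum>G\<in>S (n - 2) K. int (card (R n G))))
     \<and> (\<forall>K\<in>M (n - 1). \<forall>G |\<in>| options K. int (card (RK n G K)) =
           (if G \<noteq> 0 \<or> P_position K then 2 ^ (card (S (n - 1) G) - 1)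
            else 2 ^ (card (S (n - 1) G) - 1) - 2 ^ (card (N0 (n - 1)) - 1)))
     \<and> int (card (N n)) =
           2 ^ card (M (n - 1)) - 2 ^ card (N (n - 1)) + 1
           - (\<Sum>G\<in>N (n - 2). int (card (R n G)))
     \<and> int (card (N0 n)) =
           2 ^ (card (M (n - 1)) - 1) - 2 ^ (card (N (n - 1)) - 1)
           - (\<Sum>G\<in>N0 (n - 2). int (card (R n G)))"
  using card_M[OF assms] card_R[OF assms] card_S[OF assms] card_RK[OF assms]
    card_N[OF assms] card_N0[OF assms]
  by (intro conjI ballI) auto

end
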